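(* Let $n\ge 1$. The relation of degree $1$ homeomorphism of compact subsets of $\mathbb{C}^n$, regarded as an equivalence relation on the standard Borel space $\mathcal{K}(\mathbb{C}^n)$ of compact subsets of $\mathbb{C}^n$, is smooth.
   Context: $\mathcal{K}(\mathbb{C}^n)$ carries the Effros Borel structure. Set $z_0=1$. A degree $1$ map on a closed set $D\subset\mathbb{C}^n$ is a function $D\to\mathbb{C}^n$ of the form $(z_1,\ldots,z_n)\mapsto(f_1(z_1,\ldots,z_n),\ldots,f_n(z_1,\ldots,z_n))$ where for $1\le k\le n$ $$f_k(z_1,\ldots,z_n)=\sum_{i,j=0}^n\beta^{(k)}_{ij}z_i\bar z_j$$ on $D$ for some $\beta^{(k)}_{ij}\in\mathbb{C}$, and such that moreover for all $1\le k,m\le n$ $$f_k(z_1,\ldots,z_n)\overline{f_m(z_1,\ldots,z_n)}=\sum_{i,j=0}^n\beta^{(k,m)}_{ij}z_i\bar z_j$$ on $D$ for some $\beta^{(k,m)}_{ij}\in\mathbb{C}$. A degree $1$ homeomorphism from $D$ to $\widetilde D$ is a homeomorphism $\varphi:D\to\widetilde D$ such that $\varphi$ and $\varphi^{-1}$ are degree $1$ maps; $D$ and $\widetilde D$ are degree $1$ homeomorphic if such a $\varphi$ exists. An equivalence relation $E$ on a standard Borel space $X$ is smooth if there are a Polish space $Y$ and a Borel map $f:X\to Y$ with $x\,E\,x'\iff f(x)=f(x')$. *)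

theory Defs
  imports "HOL-Analysis.Analysis"
begin

section \<open>Smooth equivalence relations\<close>

definition polish_topology :: "'a topology \<Rightarrow> bool" where
  "polish_topology T \<longleftrightarrow> completely_metrizable_space T \<and> separable_space T"

definition borel_of :: "'a topology \<Rightarrow> 'a measure" where
  "borel_of T = sigma (topspace T) {U. openin T U}"

text \<open>Measurable spaces are encoded as \<^typ>\<open>'a measure\<close>; only \<^const>\<open>space\<close> and \<^const>\<open>sets\<close>
  matter here.\<close>

definition standard_borel :: "'a measure \<Rightarrow> bool" where
  "standard_borel X \<longleftrightarrow>
     (\<exists>T. polish_topology T \<and> topspace T = space X \<and> sets (borel_of T) = sets X)"

text \<open>HOL has no quantification over types, so the Polish space \<open>Y\<close> ranges over all Polish topologies
  on arbitrary subsets of \<^typ>\<open>nat \<Rightarrow> real\<close>. This loses no generality: every Polish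
  space is homeomorphic to a subspace of the product space of countably many real lines.\<close>

definition smooth_equivalence :: "'a measure \<Rightarrow> ('a \<times> 'a) set \<Rightarrow> bool" where
  "smooth_equivalence X E \<longleftrightarrow>
     standard_borel X \<and> equiv (space X) E \<and>
     (\<exists>(Y :: (nat \<Rightarrow> real) topology) f.
        polish_topology Y \<and> f \<in> measurable X (borel_of Y) \<and>
        (\<forall>x\<in>space X. \<forall>x'\<in>space X. (x, x') \<in> E \<longleftrightarrow> f x = f x'))"


section \<open>The space of compact subsets\<close>

text \<open>The Effros Borel structure on the compact subsets (the empty set included).\<close>

definition effros_compact :: "'a::topological_space set measure" where
  "effros_compact = sigma {K. compact K} {{K. compact K \<and> K \<inter> U \<noteq> {}} |U. open U}"


section \<open>Degree 1 homeomorphisms\<close>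

text \<open>The index set \<open>{0, 1, \<dots>, n}\<close> is modelled by \<^typ>\<open>'n option\<close>, where \<^const>\<open>None\<close> plays the
  role of the index \<open>0\<close>; the convention \<open>z\<^sub>0 = 1\<close> is built into the following function.\<close>

fun ext_coord :: "complex ^ 'n \<Rightarrow> 'n option \<Rightarrow> complex" where
  "ext_coord z None = 1"
| "ext_coord z (Some i) = z $ i"

definition sesquilinear_on :: "(complex ^ 'n::finite) set \<Rightarrow> (complex ^ 'n \<Rightarrow> complex) \<Rightarrow> bool" where
  "sesquilinear_on D h \<longleftrightarrow>
     (\<exists>\<beta> :: 'n option \<Rightarrow> 'n option \<Rightarrow> complex. \<forall>z\<in>D.
        h z = (\<Sum>i\<in>UNIV. \<Sum>j\<in>UNIV. \<beta> i j * ext_coord z i * cnj (ext_coord z j)))"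

definition degree1_map :: "(complex ^ 'n::finite) set \<Rightarrow> (complex ^ 'n \<Rightarrow> complex ^ 'n) \<Rightarrow> bool" where
  "degree1_map D f \<longleftrightarrow> closed D \<and>
     (\<forall>k. sesquilinear_on D (\<lambda>z. f z $ k)) \<and>
     (\<forall>k m. sesquilinear_on D (\<lambda>z. f z $ k * cnj (f z $ m)))"

definition degree1_homeomorphic :: "(complex ^ 'n::finite) set \<Rightarrow> (complex ^ 'n) set \<Rightarrow> bool" where
  "degree1_homeomorphic D D' \<longleftrightarrow>
     (\<exists>\<phi> \<psi>. homeomorphism D D' \<phi> \<psi> \<and> degree1_map D \<phi> \<and> degree1_map D' \<psi>)"

definition degree1_rel :: "((complex ^ 'n::finite) set \<times> (complex ^ 'n) set) set" where
  "degree1_rel = {(D, D'). compact D \<and> compact D' \<and> degree1_homeomorphic D D'}"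

end

theory Submission
  imports Defs
begin

text \<open>Send \<open>z\<close> to the matrix \<open>Q z = (z\<^sub>i cnj z\<^sub>j)\<close>. A map on \<open>D\<close> is of degree 1 iff it is induced, via
  \<open>Q\<close>, by a linear map of matrices, and a linear surjection between sets that are linear images of
  each other is invertible on their spans. So compact sets \<open>D\<close> and \<open>D'\<close> are degree 1 homeomorphic
  iff \<open>Q D\<close> and \<open>Q D'\<close> are linear images of each other.

  For a compact \<open>K\<close> in a Euclidean space the set of all its linear images is closed: maps \<open>T\<^sub>k\<close> with
  \<open>T\<^sub>k K\<close> converging are bounded on the span of \<open>K\<close>, hence subconverge there. Therefore two
  compact sets are linear images of each other iff their linear images come close to the same
  finite rational sets. These are countably many Borel conditions, and their truth values form the
  classifying map.

  Compact sets form a standard Borel space because a compact set is determined by its distance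
  functions and its maximal norm, and these data range over a closed subset of a countable power of
  the line.\<close>

section \<open>The standard Borel space of compact sets\<close>

lemma dense_sequence:
  obtains q :: "nat \<Rightarrow> 'a::euclidean_space" where "\<And>U. open U \<Longrightarrow> U \<noteq> {} \<Longrightarrow> \<exists>i. q i \<in> U"
proof -
  obtain D :: "'a set" where D: "countable D" "\<And>X. open X \<Longrightarrow> X \<noteq> {} \<Longrightarrow> \<exists>d\<in>D. d \<in> X"
    by (rule countable_dense_setE) blast
  have "D \<noteq> {}" using D(2)[OF open_UNIV] by auto
  with D(1) have "range (from_nat_into D) = D" by (simp add: range_from_nat_into)
  with D(2) have "\<exists>i. from_nat_into D i \<in> U" if "open U" "U \<noteq> {}" for U
    using that by (metis rangeE)
  then show thesis by (rule that)
qed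

lemma second_countable_euclidean:
  "second_countable (euclidean :: 'a::second_countable_topology topology)"
proof -
  obtain B :: "'a set set" where B: "countable B" "topological_basis B"
    using ex_countable_basis by blast
  show ?thesis
    unfolding second_countable_def
  proof (intro exI[of _ B] conjI allI impI ballI B(1))
    show "openin euclidean V" if "V \<in> B" for V
      using topological_basis_open[OF B(2) that] by simp
    show "\<exists>V\<in>B. x \<in> V \<and> V \<subseteq> U" if "openin euclidean U \<and> x \<in> U" for U and x :: 'a
      using topological_basisE[OF B(2), of U x] that by auto
  qed
qed

text \<open>Pulling the topology back along \<open>e\<close> turns \<open>e\<close> into a
  homeomorphism onto a closed subset of a Polish space. The open sets of the pulled-back topology
  are the preimages of open sets, so its Borel sets form the vimage algebra.\<close>

lemma standard_borel_of_closed_embedding: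
  fixes e :: "'a \<Rightarrow> 'b::polish_space"
  assumes inj: "inj_on e (space X)" and closed: "closed (e ` space X)"
    and sets: "sets X = sets (vimage_algebra (space X) e borel)"
  shows "standard_borel X"
proof -
  define T where "T = pullback_topology (space X) e euclidean"
  have ts: "topspace T = space X"
    by (simp add: T_def topspace_pullback_topology)
  have "homeomorphic_map T (top_of_set (e ` space X)) e"
  proof (rule bijective_open_imp_homeomorphic_map)
    show "continuous_map T (top_of_set (e ` space X)) e"
      using continuous_map_pullback[of euclidean euclidean id "space X" e] ts
      by (simp add: T_def continuous_map_in_subtopology)
    show "open_map T (top_of_set (e ` space X)) e"
      unfolding open_map_def
    proof (intro allI impI)
      fix U assume "openin T U"
      then obtain V where "open V" "U = e -` V \<inter> space X"
        by (auto simp: T_def openin_pullback_topology)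
      then show "openin (top_of_set (e ` space X)) (e ` U)"
        by (auto simp: openin_open intro!: exI[of _ V])
    qed
  qed (use inj ts in simp_all)
  then have hom: "T homeomorphic_space top_of_set (e ` space X)"
    by (rule homeomorphic_map_imp_homeomorphic_space)
  have "completely_metrizable_space (top_of_set (e ` space X))"
    using closed by (intro completely_metrizable_space_closedin
        completely_metrizable_space_euclidean) simp
  moreover have "separable_space (top_of_set (e ` space X))"
    by (intro second_countable_imp_separable_space second_countable_subtopology second_countable_euclidean)
  ultimately have "polish_topology T"
    unfolding polish_topology_def
    using hom homeomorphic_completely_metrizable_space homeomorphic_separable_space by blast
  moreover have "sets (borel_of T) = sets X"
  proof -
    have "borel_of T = sigma (space X) {e -` U \<inter> space X |U. U \<in> {S. open S}}"
      unfolding borel_of_def ts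
      by (rule arg_cong[where f = "sigma (space X)"]) (auto simp: T_def openin_pullback_topology, metis)
    also have "sets \<dots> = sets (vimage_algebra (space X) e (sigma UNIV {S. open S}))"
      by (subst vimage_algebra_sigma) auto
    finally show ?thesis unfolding sets borel_def .
  qed
  ultimately show ?thesis using ts unfolding standard_borel_def by blast
qed

section \<open>Limits of sequences of compact sets\<close>

text \<open>Distance functions are 1-Lipschitz, so convergence at the dense points
  \<open>q i\<close> forces convergence everywhere, to some \<open>G\<close>, and the limit set is
  the zero set of \<open>G\<close>. Convergence of the maximal norms confines all \<open>K n\<close>
  to one ball, so points selected from them accumulate.\<close>

lemma compact_limit:
  fixes K :: "nat \<Rightarrow> 'a::euclidean_space set" and q :: "nat \<Rightarrow> 'a"
  assumes q: "\<And>U. open U \<Longrightarrow> U \<noteq> {} \<Longrightarrow> \<exists>i. q i \<in> U"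
    and K: "\<And>n. compact (K n)" "\<And>n. K n \<noteq> {}"
    and s: "(\<lambda>n. Sup (norm ` K n)) \<longlonglongrightarrow> s"
    and g: "\<And>i. (\<lambda>n. infdist (q i) (K n)) \<longlonglongrightarrow> g i"
  shows "\<exists>L. compact L \<and> L \<noteq> {} \<and> Sup (norm ` L) = s \<and> (\<forall>i. infdist (q i) L = g i)"
proof -
  have le_Sup: "norm x \<le> Sup (norm ` K n)" if "x \<in> K n" for x n
    using that K(1)[of n]
    by (intro cSup_upper bounded_imp_bdd_above compact_imp_bounded compact_continuous_image)
      (auto intro: continuous_intros)
  have lip: "infdist x A \<le> dist x y + infdist y A" for x y :: 'a and A
    using infdist_triangle[of x A y] by (simp add: add.commute)
  \<comment> \<open>Three-epsilon argument: \<open>x\<close> is replaced by a dense point within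
    \<open>e/3\<close>, where the distances are known to converge.\<close>
  have "convergent (\<lambda>n. infdist x (K n))" for x
  proof (rule Cauchy_convergent, rule metric_CauchyI)
    fix e :: real assume e: "0 < e"
    then obtain i where i: "dist x (q i) < e/3"
      using q[of "ball x (e/3)"] by auto
    from g[of i] have "Cauchy (\<lambda>n. infdist (q i) (K n))" by (rule LIMSEQ_imp_Cauchy)
    then obtain N where N: "\<And>m n. m \<ge> N \<Longrightarrow> n \<ge> N \<Longrightarrow>
        dist (infdist (q i) (K m)) (infdist (q i) (K n)) < e/3"
      using e by (meson metric_CauchyD zero_less_divide_iff zero_less_numeral)
    have "dist (infdist x (K m)) (infdist x (K n)) < e" if "m \<ge> N" "n \<ge> N" for m n
      using N[OF that] i lip[of x "K m" "q i"] lip[of x "K n" "q i"]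
        lip[of "q i" "K m" x] lip[of "q i" "K n" x]
      unfolding dist_real_def dist_commute[of "q i" x] by linarith
    then show "\<exists>M. \<forall>m\<ge>M. \<forall>n\<ge>M. dist (infdist x (K m)) (infdist x (K n)) < e" by blast
  qed
  then obtain G where G: "\<And>x. (\<lambda>n. infdist x (K n)) \<longlonglongrightarrow> G x"
    unfolding convergent_def by metis
  have Gq: "G (q i) = g i" for i using G g by (rule LIMSEQ_unique)
  have G0: "0 \<le> G x" for x
    by (rule LIMSEQ_le_const[OF G]) (simp add: infdist_nonneg)
  have Glip: "G x \<le> dist x y + G y" for x y
    by (rule LIMSEQ_le[OF G tendsto_add[OF tendsto_const G]]) (use lip in blast)
  obtain S where S: "\<And>n. norm (Sup (norm ` K n)) \<le> S"
    using convergent_imp_Bseq[of "\<lambda>n. Sup (norm ` K n)"] s by (auto simp: convergent_def Bseq_def)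
  \<comment> \<open>Selections from the sets \<open>K n\<close> stay in the ball of radius
    \<open>S\<close>, and their accumulation points have distance tending to 0 from the
    sets.\<close>
  have subseq: "\<exists>y r. G y = 0 \<and> strict_mono r \<and> (d \<circ> r) \<longlonglongrightarrow> y" if d: "\<And>n. d n \<in> K n" for d :: "nat \<Rightarrow> 'a"
  proof -
    have "d n \<in> cball 0 S" for n using le_Sup[OF d, of n] S[of n] by simp
    then obtain y r where r: "strict_mono r" "(d \<circ> r) \<longlonglongrightarrow> y"
      using compact_cball[of 0 S] unfolding compact_def by metis
    have "(\<lambda>n. dist y ((d \<circ> r) n)) \<longlonglongrightarrow> dist y y" by (intro tendsto_intros r)
    moreover have Gy: "(\<lambda>n. infdist y (K (r n))) \<longlonglongrightarrow> G y"
      using LIMSEQ_subseq_LIMSEQ[OF G[of y] r(1)] by (simp add: o_def)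
    moreover have "infdist y (K (r n)) \<le> dist y ((d \<circ> r) n)" for n
      using infdist_le[OF d] by simp
    ultimately have "G y \<le> dist y y"
      using LIMSEQ_le[OF Gy] by blast
    then show ?thesis using r G0[of y] by force
  qed
  \<comment> \<open>The points of \<open>K n\<close> nearest to \<open>x\<close> accumulate at a
    zero of \<open>G\<close> whose distance from \<open>x\<close> is \<open>G x\<close>. This later
    identifies \<open>G\<close> with the distance to the limit set.\<close>
  have near: "\<exists>y. G y = 0 \<and> dist x y = G x" for x
  proof -
    have "\<exists>d\<in>K n. infdist x (K n) = dist x d" for n
      using infdist_attains_inf[of "K n" x] K by (metis compact_imp_closed)
    then obtain d where d: "\<And>n. d n \<in> K n" "\<And>n. infdist x (K n) = dist x (d n)" by metis
    from subseq[of d, OF d(1)] obtain y r where y: "G y = 0" "strict_mono r" "(d \<circ> r) \<longlonglongrightarrow> y" by blast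
    have "(\<lambda>n. dist x ((d \<circ> r) n)) \<longlonglongrightarrow> dist x y" by (intro tendsto_intros y)
    moreover have "(\<lambda>n. dist x ((d \<circ> r) n)) \<longlonglongrightarrow> G x"
      using LIMSEQ_subseq_LIMSEQ[OF G[of x] y(2)] by (simp add: o_def d)
    ultimately show ?thesis using y LIMSEQ_unique by blast
  qed
  define L where "L = {x. G x = 0}"
  have normL: "norm x \<le> s" if "x \<in> L" for x
  proof -
    have "norm x \<le> Sup (norm ` K n) + infdist x (K n)" for n
    proof -
      obtain d where d: "d \<in> K n" "infdist x (K n) = dist x d"
        using infdist_attains_inf[of "K n" x] K by (metis compact_imp_closed)
      have "norm x \<le> norm d + dist x d"
        by (metis add.commute dist_norm norm_triangle_sub)
      then show ?thesis using d le_Sup[OF d(1)] by simp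
    qed
    moreover have "(\<lambda>n. Sup (norm ` K n) + infdist x (K n)) \<longlonglongrightarrow> s + G x"
      by (intro tendsto_intros s G)
    ultimately have "norm x \<le> s + G x" by (intro LIMSEQ_le_const) auto
    with that show ?thesis by (simp add: L_def)
  qed
  have "closed L"
    unfolding closed_sequential_limits
  proof (intro allI impI)
    fix x l assume *: "(\<forall>n. x n \<in> L) \<and> x \<longlonglongrightarrow> l"
    have "G l \<le> dist l (x n)" for n using Glip[of l "x n"] * by (simp add: L_def)
    moreover have "(\<lambda>n. dist l (x n)) \<longlonglongrightarrow> dist l l" using * by (intro tendsto_intros) auto
    ultimately have "G l \<le> dist l l" by (intro LIMSEQ_le_const) auto
    then show "l \<in> L" using G0[of l] by (simp add: L_def)
  qed
  moreover have "bounded L" using normL by (auto simp: bounded_iff)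
  ultimately have "compact L" by (simp add: compact_eq_bounded_closed)
  moreover have ne: "L \<noteq> {}" using near by (auto simp: L_def)
  moreover have "Sup (norm ` L) = s"
  proof (rule cSup_eq_maximum)
    show "y \<le> s" if "y \<in> norm ` L" for y using that normL by auto
    \<comment> \<open>Points of maximal norm accumulate at a point of \<open>L\<close> of norm
      \<open>s\<close>, so the maximal norm does not drop in the limit.\<close>
    have "\<exists>x\<in>K n. norm x = Sup (norm ` K n)" for n
    proof -
      have "compact (norm ` K n)" using K by (intro compact_continuous_image) (auto intro: continuous_intros)
      then have "Sup (norm ` K n) \<in> norm ` K n"
        using K(2) by (intro closed_contains_Sup) (auto simp: compact_imp_closed bounded_imp_bdd_above compact_imp_bounded)
      then show ?thesis by force
    qed
    then obtain d where d: "\<And>n. d n \<in> K n" "\<And>n. norm (d n) = Sup (norm ` K n)" by metis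
    from subseq[of d, OF d(1)] obtain y r where y: "G y = 0" "strict_mono r" "(d \<circ> r) \<longlonglongrightarrow> y" by blast
    have "(\<lambda>n. norm ((d \<circ> r) n)) \<longlonglongrightarrow> norm y" by (intro tendsto_intros y)
    moreover have "(\<lambda>n. norm ((d \<circ> r) n)) \<longlonglongrightarrow> s"
      using LIMSEQ_subseq_LIMSEQ[OF s y(2)] by (simp add: o_def d)
    ultimately have "norm y = s" by (rule LIMSEQ_unique)
    then show "s \<in> norm ` L" using y by (auto simp: L_def)
  qed
  moreover have "infdist (q i) L = g i" for i
  proof (rule antisym)
    obtain y where "G y = 0" "dist (q i) y = G (q i)" using near by blast
    then show "infdist (q i) L \<le> g i" using infdist_le[of y L "q i"] Gq by (auto simp: L_def)
    show "g i \<le> infdist (q i) L"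
      unfolding infdist_notempty[OF ne]
    proof (rule cINF_greatest[OF ne])
      fix z assume "z \<in> L"
      then show "g i \<le> dist (q i) z" using Glip[of "q i" z] Gq by (simp add: L_def)
    qed
  qed
  ultimately show ?thesis by blast
qed

section \<open>The Effros structure in terms of distance functions\<close>

lemma space_effros_compact: "space effros_compact = {K. compact K}"
  unfolding effros_compact_def by (intro space_measure_of) auto

lemma sets_effros_compact:
  "sets effros_compact = sigma_sets {K. compact K} {{K. compact K \<and> K \<inter> U \<noteq> {}} |U. open U}"
  unfolding effros_compact_def by (intro sets_measure_of) auto

lemma hits_in_effros:
  assumes "open U"
  shows "{K. compact K \<and> K \<inter> U \<noteq> {}} \<in> sets effros_compact"
  unfolding sets_effros_compact using assms by (intro sigma_sets.Basic) auto

text \<open>Translates distance functions into the hit sets that generate the Effros structure.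
  Nonemptiness matters because \<open>infdist x {}\<close> is 0.\<close>

lemma infdist_less_iff_hits:
  assumes "A \<noteq> {}"
  shows "infdist x A < r \<longleftrightarrow> A \<inter> ball x r \<noteq> {}"
proof
  assume "infdist x A < r"
  then have "\<exists>a\<in>A. dist x a < r"
    using assms by (subst (asm) infdist_notempty) (auto simp: cINF_less_iff)
  then show "A \<inter> ball x r \<noteq> {}" by auto
next
  assume "A \<inter> ball x r \<noteq> {}"
  then obtain a where "a \<in> A" "dist x a < r" by auto
  then show "infdist x A < r" using infdist_le[of a A x] by simp
qed

text \<open>The coordinates of the embedding \<open>e\<close> are measurable because their level
  conditions are hit sets, up to the empty set. Conversely an open set is a countable union of balls
  whose hit sets can be read off two coordinates. Closedness of the image comes from
  \<open>compact_limit\<close>.\<close>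

theorem standard_borel_effros_compact:
  "standard_borel (effros_compact :: 'a::euclidean_space set measure)"
proof -
  let ?X = "effros_compact :: 'a set measure"
  note sp = space_effros_compact
  obtain q :: "nat \<Rightarrow> 'a" where q: "\<And>U. open U \<Longrightarrow> U \<noteq> {} \<Longrightarrow> \<exists>i. q i \<in> U"
    using dense_sequence by blast
  \<comment> \<open>The value \<open>-1\<close> isolates the empty set. The \<open>Sup\<close> coordinate keeps limits of compact sets
    bounded, which makes the image closed.\<close>
  define e :: "'a set \<Rightarrow> nat \<Rightarrow> real" where
    "e K n = (if K = {} then - 1 else case n of 0 \<Rightarrow> Sup (norm ` K) | Suc i \<Rightarrow> infdist (q i) K)" for K n
  have e_empty: "e {} = (\<lambda>n. - 1)" by (auto simp: e_def)
  have Sup_less: "r < Sup (norm ` K) \<longleftrightarrow> K \<inter> {x. r < norm x} \<noteq> {}" if "compact K" "K \<noteq> {}" for K :: "'a set" and r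
  proof -
    have "bdd_above (norm ` K)" using that(1)
      by (intro bounded_imp_bdd_above compact_imp_bounded compact_continuous_image) (auto intro: continuous_intros)
    then show ?thesis using that(2) by (subst less_cSup_iff) auto
  qed
  have e0: "0 \<le> e K 0 \<longleftrightarrow> K \<noteq> {}" if "compact K" for K
  proof (cases "K = {}")
    case False
    then have "\<not> Sup (norm ` K) < 0"
      using Sup_less[of K "Sup (norm ` K)"] that False norm_ge_zero
      by (smt (verit, best) disjoint_iff ex_in_conv mem_Collect_eq)
    then show ?thesis using False by (simp add: e_def)
  qed (simp add: e_def)
  have empty_meas: "{{}} \<in> sets ?X"
  proof -
    have "space ?X - {K. compact K \<and> K \<inter> UNIV \<noteq> {}} \<in> sets ?X"
      by (intro sets.compl_sets hits_in_effros) simp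
    also have "space ?X - {K. compact K \<and> K \<inter> UNIV \<noteq> {}} = {{}}" by (auto simp: sp)
    finally show ?thesis .
  qed
  \<comment> \<open>The test on coordinate 0 rules out the empty set, whose value -1 at
    \<open>Suc i\<close> would pass the second test for every \<open>r > -1\<close>.\<close>
  have ball_hit: "compact K \<Longrightarrow> K \<inter> ball (q i) r \<noteq> {} \<longleftrightarrow> 0 \<le> e K 0 \<and> e K (Suc i) < r" for K i r
    using e0[of K] infdist_less_iff_hits[of K "q i" r] by (auto simp: e_def)
  show ?thesis
  proof (rule standard_borel_of_closed_embedding)
    show "inj_on e (space ?X)"
    proof (rule inj_onI)
      fix K L assume KL: "K \<in> space ?X" "L \<in> space ?X" "e K = e L"
      \<comment> \<open>A point of \<open>K\<close> outside \<open>L\<close> lies in a ball around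
        some \<open>q i\<close> that misses \<open>L\<close>, but by \<open>ball_hit\<close> equal
        codes hit the same such balls.\<close>
      have sub: "K \<subseteq> L" if KL: "compact K" "compact L" "e K = e L" for K L
      proof (rule ccontr)
        assume "\<not> K \<subseteq> L"
        then obtain x where x: "x \<in> K" "x \<notin> L" by auto
        then obtain r where r: "r > 0" "ball x r \<subseteq> - L"
          using KL(2) by (metis ComplI compact_imp_closed open_Compl open_contains_ball)
        obtain i where i: "dist x (q i) < r/2" using q[of "ball x (r/2)"] r by auto
        have "x \<in> K \<inter> ball (q i) (r/2)" using x i by (simp add: dist_commute)
        then have "L \<inter> ball (q i) (r/2) \<noteq> {}"
          using ball_hit[OF KL(1)] ball_hit[OF KL(2)] KL(3) by (metis empty_iff)
        then obtain y where "y \<in> L" "dist (q i) y < r/2" by auto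
        with i have "dist x y < r" using dist_triangle[of x y "q i"] by linarith
        with r \<open>y \<in> L\<close> show False by auto
      qed
      show "K = L" using sub[of K L] sub[of L K] KL sp by auto
    qed
    show "closed (e ` space ?X)"
      unfolding closed_sequential_limits
    proof (intro allI impI)
      fix y l assume *: "(\<forall>n. y n \<in> e ` space ?X) \<and> y \<longlonglongrightarrow> l"
      then obtain K where K: "\<And>n. compact (K n)" "\<And>n. y n = e (K n)"
        unfolding sp image_iff by (metis mem_Collect_eq)
      have lim: "(\<lambda>n. y n i) \<longlonglongrightarrow> l i" for i
      proof -
        have "continuous_on UNIV (\<lambda>y :: nat \<Rightarrow> real. y i)" by simp
        from continuous_on_tendsto_compose[OF this, of y l] * show ?thesis by simp
      qed
      show "l \<in> e ` space ?X"
      proof (cases "l 0 < 0")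
        case True
        then have "\<forall>\<^sub>F n in sequentially. y n 0 < 0" by (rule order_tendstoD[OF lim])
        then have ev: "\<forall>\<^sub>F n in sequentially. y n = (\<lambda>_. - 1)"
          by eventually_elim (use e0 K e_empty in \<open>metis not_less\<close>)
        have "y \<longlonglongrightarrow> (\<lambda>_. - 1)" by (rule tendsto_eventually[OF ev])
        then have "l = (\<lambda>_. - 1)" using * LIMSEQ_unique by blast
        then have "l = e {}" by (simp add: e_empty)
        then show ?thesis by (simp add: sp)
      next
        case False
        \<comment> \<open>A coordinate 0 above -1 excludes the empty set, so after the first
          \<open>N\<close> terms only nonempty sets remain and \<open>compact_limit\<close>
          applies.\<close>
        then have "- 1 < l 0" by simp
        then have "\<forall>\<^sub>F n in sequentially. - 1 < y n 0" by (rule order_tendstoD[OF lim])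
        then obtain N where N: "\<And>n. n \<ge> N \<Longrightarrow> - 1 < y n 0"
          unfolding eventually_sequentially by blast
        define M where "M n = K (n + N)" for n
        have ne: "M n \<noteq> {}" for n
          using N[of "n + N"] K(2)[of "n + N"] e_empty by (auto simp: M_def)
        have lim': "(\<lambda>n. e (M n) i) \<longlonglongrightarrow> l i" for i
          using LIMSEQ_ignore_initial_segment[OF lim[of i], of N] K(2) by (simp add: M_def)
        have "\<exists>L. compact L \<and> L \<noteq> {} \<and> Sup (norm ` L) = l 0 \<and> (\<forall>i. infdist (q i) L = l (Suc i))"
        proof (rule compact_limit[OF q])
          show "compact (M n)" "M n \<noteq> {}" for n using K ne by (auto simp: M_def)
          show "(\<lambda>n. Sup (norm ` M n)) \<longlonglongrightarrow> l 0" using lim'[of 0] ne by (simp add: e_def)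
          show "(\<lambda>n. infdist (q i) (M n)) \<longlonglongrightarrow> l (Suc i)" for i
            using lim'[of "Suc i"] ne by (simp add: e_def)
        qed
        then obtain L where L: "compact L" "L \<noteq> {}" "Sup (norm ` L) = l 0" "\<And>i. infdist (q i) L = l (Suc i)"
          by blast
        have "l = e L" using L by (auto simp: e_def fun_eq_iff split: nat.split)
        then show ?thesis using L sp by auto
      qed
    qed
    have meas: "e \<in> borel_measurable ?X"
    proof (rule measurable_coordinatewise_then_product)
      fix n
      show "(\<lambda>K. e K n) \<in> borel_measurable ?X"
      proof (cases n)
        case 0
        show ?thesis unfolding borel_measurable_iff_greater
        proof
          fix r :: real
          \<comment> \<open>The empty set has value -1, so it belongs to this level set exactly when
            \<open>r < -1\<close>.\<close>
          have "{K \<in> space ?X. r < e K n} = {K. compact K \<and> K \<inter> {x. r < norm x} \<noteq> {}} \<union> (if r < - 1 then {{}} else {})"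
            using Sup_less by (auto simp: e_def sp 0)
          also have "\<dots> \<in> sets ?X"
            using empty_meas by (intro sets.Un hits_in_effros open_Collect_less continuous_intros) auto
          finally show "{K \<in> space ?X. r < e K n} \<in> sets ?X" .
        qed
      next
        case (Suc i)
        show ?thesis unfolding borel_measurable_iff_less
        proof
          fix r :: real
          have "{K \<in> space ?X. e K n < r} = {K. compact K \<and> K \<inter> ball (q i) r \<noteq> {}} \<union> (if - 1 < r then {{}} else {})"
            using infdist_less_iff_hits[of _ "q i" r] by (auto simp: e_def sp Suc)
          also have "\<dots> \<in> sets ?X"
            using empty_meas by (intro sets.Un hits_in_effros) auto
          finally show "{K \<in> space ?X. e K n < r} \<in> sets ?X" .
        qed
      qed
    qed
    show "sets ?X = sets (vimage_algebra (space ?X) e borel)"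
    proof
      show "sets (vimage_algebra (space ?X) e borel) \<subseteq> sets ?X"
        using meas by (intro sets_image_in_sets) auto
      let ?V = "vimage_algebra (space ?X) e borel"
      have "{K. compact K \<and> K \<inter> U \<noteq> {}} \<in> sets ?V" if U: "open U" for U
      proof -
        define I where "I = {(i, r). r \<in> \<rat> \<and> ball (q i) r \<subseteq> U}"
        have "countable I"
          by (rule countable_subset[of _ "UNIV \<times> \<rat>"]) (auto simp: I_def countable_rat)
        have ball: "{K. compact K \<and> K \<inter> ball (q i) r \<noteq> {}} \<in> sets ?V" for i r
        proof -
          have "e -` {y. 0 \<le> y 0 \<and> y (Suc i) < r} \<inter> space ?X \<in> sets ?V"
          proof (rule in_vimage_algebra)
            have m: "(\<lambda>y. y k) \<in> borel_measurable (borel :: (nat \<Rightarrow> real) measure)" for k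
              by (intro borel_measurable_continuous_onI continuous_on_product_coordinates)
            have "{y \<in> space borel. 0 \<le> y 0 \<and> y (Suc i) < r} \<in> sets (borel :: (nat \<Rightarrow> real) measure)"
              using m by measurable
            then show "{y. 0 \<le> y 0 \<and> y (Suc i) < r} \<in> sets (borel :: (nat \<Rightarrow> real) measure)" by simp
          qed
          also have "e -` {y. 0 \<le> y 0 \<and> y (Suc i) < r} \<inter> space ?X = {K. compact K \<and> K \<inter> ball (q i) r \<noteq> {}}"
            using ball_hit by (auto simp: sp)
          finally show ?thesis .
        qed
        have "\<exists>(i, r)\<in>I. x \<in> ball (q i) r" if x: "x \<in> U" for x
        proof -
          obtain d where d: "d > 0" "ball x d \<subseteq> U" using x U open_contains_ball by blast
          obtain i where i: "dist x (q i) < d/3" using q[of "ball x (d/3)"] d by auto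
          \<comment> \<open>Since \<open>q i\<close> is within \<open>d/3\<close> of
            \<open>x\<close>, a radius above \<open>d/3\<close> captures \<open>x\<close>, and one
            below \<open>d/2\<close> keeps the ball inside \<open>ball x d\<close>.\<close>
          obtain r where r: "r \<in> \<rat>" "d/3 < r" "r < d/2" using Rats_dense_in_real[of "d/3" "d/2"] d by auto
          have "ball (q i) r \<subseteq> ball x d"
            using i r by (intro ball_subset_ball_iff[THEN iffD2]) (simp add: dist_commute)
          then have "(i, r) \<in> I" using d r by (auto simp: I_def)
          moreover have "x \<in> ball (q i) r" using i r by (simp add: dist_commute)
          ultimately show ?thesis by blast
        qed
        then have "{K. compact K \<and> K \<inter> U \<noteq> {}} = (\<Union>(i, r)\<in>I. {K. compact K \<and> K \<inter> ball (q i) r \<noteq> {}})"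
          by (fastforce simp: I_def)
        also have "\<dots> \<in> sets ?V"
          using ball \<open>countable I\<close> by (intro sets.countable_UN') auto
        finally show ?thesis .
      qed
      then have "{{K. compact K \<and> K \<inter> U \<noteq> {}} |U. open U} \<subseteq> sets ?V" by blast
      from sets.sigma_sets_subset[OF this] show "sets ?X \<subseteq> sets ?V"
        by (simp add: sets_effros_compact sp)
    qed
  qed
qed

section \<open>Linear images of compact sets\<close>

text \<open>Says that \<open>K'\<close> is a limit, in the Hausdorff distance, of linear images of
  \<open>K\<close>.\<close>

definition linear_images_dense_at :: "'a::euclidean_space set \<Rightarrow> 'a set \<Rightarrow> bool" where
  "linear_images_dense_at K K' \<longleftrightarrow> (\<forall>e>0. \<exists>T. linear T \<and>
     (\<forall>x\<in>K. \<exists>y\<in>K'. dist (T x) y < e) \<and> (\<forall>y\<in>K'. \<exists>x\<in>K. dist (T x) y < e))"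

text \<open>A basis \<open>B\<close> of the span of \<open>K\<close> is chosen inside
  \<open>K\<close>, so every \<open>T k\<close> sends its elements to within distance 1 of the
  bounded set \<open>K'\<close>. This bounds the maps on the span. Bounded operators in finite
  dimension subconverge, and the limit maps \<open>K\<close> onto \<open>K'\<close>.\<close>

lemma linear_image_of_limit:
  fixes K K' :: "'a::euclidean_space set"
  assumes K: "compact K" and K': "compact K'" and dense: "linear_images_dense_at K K'"
  shows "\<exists>T. linear T \<and> T ` K = K'"
proof -
  have "\<forall>k. \<exists>T. linear T \<and> (\<forall>x\<in>K. \<exists>y\<in>K'. dist (T x) y < 1 / real (Suc k)) \<and>
      (\<forall>y\<in>K'. \<exists>x\<in>K. dist (T x) y < 1 / real (Suc k))"
    using dense unfolding linear_images_dense_at_def by simp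
  then obtain T where T: "\<And>k. linear (T k)"
    "\<And>k x. x \<in> K \<Longrightarrow> \<exists>y\<in>K'. dist (T k x) y < 1 / real (Suc k)"
    "\<And>k y. y \<in> K' \<Longrightarrow> \<exists>x\<in>K. dist (T k x) y < 1 / real (Suc k)"
    by metis
  obtain B where B: "B \<subseteq> K" "independent B" "K \<subseteq> span B" "finite B"
    using basis_exists[of K] independent_imp_finite by metis
  \<comment> \<open>The coordinate functionals of the basis \<open>B\<close>, extended to the whole
    space.\<close>
  have "\<forall>b\<in>B. \<exists>c. linear c \<and> (\<forall>b'\<in>B. c b' = (if b' = b then 1 else 0 :: real))"
  proof
    fix b assume "b \<in> B"
    show "\<exists>c. linear c \<and> (\<forall>b'\<in>B. c b' = (if b' = b then 1 else 0 :: real))"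
      by (rule linear_independent_extend[OF B(2)])
  qed
  then obtain c where c: "\<And>b. b \<in> B \<Longrightarrow> linear (c b)"
    "\<And>b b'. b \<in> B \<Longrightarrow> b' \<in> B \<Longrightarrow> c b b' = (if b' = b then 1 else 0 :: real)"
    by metis
  have "\<forall>b\<in>B. \<exists>C. \<forall>x. norm (c b x) \<le> C * norm x"
    using c(1) linear_bounded by blast
  then obtain C where C: "\<And>b x. b \<in> B \<Longrightarrow> norm (c b x) \<le> C b * norm x" by metis
  have C0: "0 \<le> C b" if "b \<in> B" for b
    \<comment> \<open>A basis vector has norm 1, so the bound evaluated there is \<open>C b\<close>
      itself.\<close>
    using C[OF that, of "SOME i. i \<in> Basis"]
    by (metis norm_Basis norm_ge_zero mult.right_neutral order_trans some_in_eq nonempty_Basis)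
  obtain R where R: "\<And>y. y \<in> K' \<Longrightarrow> norm y \<le> R"
    using compact_imp_bounded[OF K'] by (auto simp: bounded_iff)
  have TB: "norm (T k b) \<le> R + 1" if "b \<in> B" for k b
  proof -
    have "b \<in> K" using that B by auto
    then obtain y where y: "y \<in> K'" "dist (T k b) y < 1 / real (Suc k)" using T(2) by blast
    have "1 / real (Suc k) \<le> 1" by simp
    then have "dist (T k b) y < 1" using y(2) by linarith
    moreover have "norm (T k b) \<le> norm y + dist (T k b) y"
      by (simp add: dist_norm norm_triangle_sub)
    ultimately show ?thesis using R[OF y(1)] by linarith
  qed
  \<comment> \<open>\<open>T k\<close> is uncontrolled outside the span of \<open>K\<close>; \<open>T' k\<close> agrees with it on that span and is
    uniformly bounded.\<close>
  define T' where "T' k x = (\<Sum>b\<in>B. c b x *\<^sub>R T k b)" for k x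
  have lin: "linear (T' k)" for k
  proof (rule linearI)
    fix x y and r :: real
    show "T' k (x + y) = T' k x + T' k y"
      using c(1) by (simp add: T'_def linear_add scaleR_add_left sum.distrib)
    show "T' k (r *\<^sub>R x) = r *\<^sub>R T' k x"
      using c(1) by (simp add: T'_def linear_scale scaleR_sum_right)
  qed
  have eq: "T' k x = T k x" if "x \<in> K" for k x
  proof (rule linear_eq_on_span[OF lin T(1), of B])
    show "x \<in> span B" using that B by auto
    fix b assume "b \<in> B"
    have "T' k b = (\<Sum>b'\<in>B. (if b = b' then T k b' else 0))"
      unfolding T'_def by (rule sum.cong) (auto simp: c \<open>b \<in> B\<close>)
    then show "T' k b = T k b" using \<open>b \<in> B\<close> B(4) by simp
  qed
  define f where "f k = Blinfun (T' k)" for k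
  have f: "blinfun_apply (f k) = T' k" for k
    unfolding f_def using lin by (intro bounded_linear_Blinfun_apply) (simp add: linear_linear)
  have "norm (f k) \<le> (\<Sum>b\<in>B. C b * \<bar>R + 1\<bar>)" for k
  proof (rule norm_blinfun_bound)
    show "0 \<le> (\<Sum>b\<in>B. C b * \<bar>R + 1\<bar>)" using C0 by (intro sum_nonneg) simp
    fix x
    have "norm (T' k x) \<le> (\<Sum>b\<in>B. norm (c b x *\<^sub>R T k b))"
      unfolding T'_def by (rule norm_sum)
    also have "\<dots> \<le> (\<Sum>b\<in>B. (C b * norm x) * \<bar>R + 1\<bar>)"
    proof (rule sum_mono)
      fix b assume b: "b \<in> B"
      have "norm (c b x) * norm (T k b) \<le> (C b * norm x) * \<bar>R + 1\<bar>"
        using C[OF b, of x] TB[OF b, of k] C0[OF b] by (intro mult_mono) auto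
      then show "norm (c b x *\<^sub>R T k b) \<le> (C b * norm x) * \<bar>R + 1\<bar>" by simp
    qed
    finally show "norm (blinfun_apply (f k) x) \<le> (\<Sum>b\<in>B. C b * \<bar>R + 1\<bar>) * norm x"
      by (simp add: f sum_distrib_left mult.commute mult.left_commute)
  qed
  then have "bounded (range f)" by (auto simp: bounded_iff)
  then obtain l r where r: "strict_mono r" "(f \<circ> r) \<longlonglongrightarrow> l"
    using bounded_imp_convergent_subsequence by blast
  have seq0: "(\<lambda>k. 1 / real (Suc (r k))) \<longlonglongrightarrow> 0"
    using LIMSEQ_subseq_LIMSEQ[OF LIMSEQ_inverse_real_of_nat r(1)] by (simp add: o_def inverse_eq_divide)
  have lim: "(\<lambda>k. T (r k) x) \<longlonglongrightarrow> blinfun_apply l x" if "x \<in> K" for x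
  proof -
    have "(\<lambda>k. blinfun_apply ((f \<circ> r) k) x) \<longlonglongrightarrow> blinfun_apply l x"
      by (intro tendsto_intros r)
    then show ?thesis using eq[OF that] by (simp add: f)
  qed
  have "blinfun_apply l ` K = K'"
  proof
    show "blinfun_apply l ` K \<subseteq> K'"
    proof
      fix z assume "z \<in> blinfun_apply l ` K"
      then obtain x where x: "x \<in> K" "z = blinfun_apply l x" by auto
      have "\<forall>k. \<exists>y. y \<in> K' \<and> dist (T (r k) x) y < 1 / real (Suc (r k))"
        using T(2)[OF x(1)] by blast
      from choice[OF this] obtain y where
        y: "\<And>k. y k \<in> K'" "\<And>k. dist (T (r k) x) (y k) < 1 / real (Suc (r k))"
        by blast
      have "(\<lambda>k. T (r k) x - y k) \<longlonglongrightarrow> 0"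
        by (rule Lim_null_comparison[OF _ seq0]) (use y(2) in \<open>auto simp: dist_norm less_imp_le\<close>)
      from tendsto_diff[OF lim[OF x(1)] this] have "y \<longlonglongrightarrow> z" by (simp add: x)
      then show "z \<in> K'" using y(1) compact_imp_closed[OF K'] closed_sequential_limits by blast
    qed
    show "K' \<subseteq> blinfun_apply l ` K"
    proof
      fix y assume y: "y \<in> K'"
      have "\<forall>k. \<exists>x. x \<in> K \<and> dist (T (r k) x) y < 1 / real (Suc (r k))"
        using T(3)[OF y] by blast
      from choice[OF this] obtain x where
        x: "\<And>k. x k \<in> K" "\<And>k. dist (T (r k) (x k)) y < 1 / real (Suc (r k))"
        by blast
      obtain M where M: "\<And>x. x \<in> K \<Longrightarrow> norm x \<le> M"
        using compact_imp_bounded[OF K] by (auto simp: bounded_iff)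
      \<comment> \<open>The points \<open>x k\<close> vary with \<open>k\<close>, so pointwise
        convergence does not suffice. Operator norm convergence is uniform on \<open>K\<close>,
        whose norms are bounded by \<open>M\<close>.\<close>
      have bound: "norm (blinfun_apply l (x k) - y) \<le> norm (l - (f \<circ> r) k) * M + 1 / real (Suc (r k))" for k
      proof -
        have "norm (blinfun_apply l (x k) - y) \<le> norm (blinfun_apply l (x k) - T (r k) (x k)) + norm (T (r k) (x k) - y)"
          using norm_triangle_ineq[of "blinfun_apply l (x k) - T (r k) (x k)" "T (r k) (x k) - y"] by simp
        moreover have "norm (blinfun_apply l (x k) - T (r k) (x k)) = norm (blinfun_apply (l - (f \<circ> r) k) (x k))"
          using eq[OF x(1)] by (simp add: blinfun.bilinear_simps f)
        moreover have "\<dots> \<le> norm (l - (f \<circ> r) k) * norm (x k)" by (rule norm_blinfun)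
        moreover have "\<dots> \<le> norm (l - (f \<circ> r) k) * M" by (intro mult_left_mono M x) auto
        ultimately show ?thesis using x(2)[of k] by (simp add: dist_norm)
      qed
      have "(\<lambda>k. norm (l - (f \<circ> r) k) * M + 1 / real (Suc (r k))) \<longlonglongrightarrow> norm (l - l) * M + 0"
        by (intro tendsto_intros r seq0)
      then have "(\<lambda>k. norm (l - (f \<circ> r) k) * M + 1 / real (Suc (r k))) \<longlonglongrightarrow> 0" by simp
      then have "(\<lambda>k. blinfun_apply l (x k) - y) \<longlonglongrightarrow> 0"
        by (rule Lim_null_comparison[OF always_eventually[OF allI[OF bound]]])
      then have "(\<lambda>k. blinfun_apply l (x k)) \<longlonglongrightarrow> y" by (simp add: LIM_zero_iff)
      moreover have "closed (blinfun_apply l ` K)"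
        by (intro compact_imp_closed compact_continuous_image K) (auto intro!: continuous_intros)
      ultimately show "y \<in> blinfun_apply l ` K"
        using closed_sequentially[of "blinfun_apply l ` K" "\<lambda>k. blinfun_apply l (x k)" y] x(1) by blast
    qed
  qed
  moreover have "linear (blinfun_apply l)"
    using blinfun.bounded_linear_right[of l] by (simp add: linear_linear)
  ultimately show ?thesis by blast
qed

section \<open>Countably many Borel conditions on linear images\<close>

text \<open>The two balls differ (closed in the first clause, open in the second) because
  ``\<open>K\<close> is contained in a closed set'' and ``\<open>K\<close> meets an open set'' are the conditions that are
  immediately Effros measurable. The strict slack \<open>d < e\<close> makes the predicate insensitive to
  small perturbations of \<open>T\<close>, so that countably many \<open>T\<close> suffice.\<close>

definition approx_image :: "'a::euclidean_space set \<Rightarrow> real \<Rightarrow> 'a set \<Rightarrow> bool" where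
  "approx_image F e K \<longleftrightarrow> (\<exists>T d. linear T \<and> d < e \<and>
     T ` K \<subseteq> (\<Union>p\<in>F. cball p d) \<and> (\<forall>p\<in>F. T ` K \<inter> ball p d \<noteq> {}))"

text \<open>Composing the approximating map with \<open>S\<close> transfers the condition, so sets
  that are linear images of each other satisfy the same conditions.\<close>

lemma approx_image_linear_image:
  assumes "approx_image F e (S ` K)" "linear S"
  shows "approx_image F e K"
proof -
  obtain T d where "linear T" "d < e" "T ` S ` K \<subseteq> (\<Union>p\<in>F. cball p d)"
      "\<forall>p\<in>F. T ` S ` K \<inter> ball p d \<noteq> {}"
    using assms unfolding approx_image_def by blast
  then show ?thesis unfolding approx_image_def
    using linear_compose[OF assms(2)] by (intro exI[of _ "T \<circ> S"] exI[of _ d]) (simp add: image_comp)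
qed

text \<open>With the identity as linear map, \<open>K'\<close> satisfies the conditions given by its
  own finite nets. Transferred to \<open>K\<close>, they produce linear images of \<open>K\<close>
  arbitrarily close to \<open>K'\<close>, and \<open>linear_image_of_limit\<close> applies.\<close>

lemma linear_image_if_approx_image:
  fixes K K' :: "'a::euclidean_space set"
  assumes K: "compact K" and K': "compact K'"
    and q: "\<And>U::'a set. open U \<Longrightarrow> U \<noteq> {} \<Longrightarrow> \<exists>i. q i \<in> U"
    and approx: "\<And>F k. finite F \<Longrightarrow> F \<subseteq> range q \<Longrightarrow>
      approx_image F (1 / real (Suc k)) K' \<Longrightarrow> approx_image F (1 / real (Suc k)) K"
  shows "\<exists>T. linear T \<and> T ` K = K'"
proof (rule linear_image_of_limit[OF K K'])
  show "linear_images_dense_at K K'"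
    unfolding linear_images_dense_at_def
  proof (intro allI impI)
    fix e :: real assume "e > 0"
    \<comment> \<open>Two errors, each below \<open>1 / real (Suc k)\<close>, will be added by the
      triangle inequality.\<close>
    then obtain k where k: "1 / real (Suc k) < e / 2"
      using nat_approx_posE[of "e / 2"] by auto
    define d where "d = 1 / real (Suc k) / 2"
    have d: "0 < d" "d < 1 / real (Suc k)" by (simp_all add: d_def divide_strict_left_mono)
    have "K' \<subseteq> (\<Union>i\<in>UNIV. ball (q i) d)"
    proof
      fix x assume "x \<in> K'"
      from q[of "ball x d"] d obtain i where "dist x (q i) < d" by auto
      then show "x \<in> (\<Union>i\<in>UNIV. ball (q i) d)" by (auto simp: dist_commute)
    qed
    then obtain I where I: "finite I" "K' \<subseteq> (\<Union>i\<in>I. ball (q i) d)"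
      using compactE_image[OF K', of UNIV "\<lambda>i. ball (q i) d"] by auto
    \<comment> \<open>Centers whose ball misses \<open>K'\<close> are dropped, so that every
      remaining ball is hit; the remaining balls still cover \<open>K'\<close>.\<close>
    define F where "F = {p \<in> q ` I. K' \<inter> ball p d \<noteq> {}}"
    have F: "finite F" "F \<subseteq> range q" using I by (auto simp: F_def)
    have KF: "K' \<subseteq> (\<Union>p\<in>F. ball p d)"
    proof
      fix x assume "x \<in> K'"
      moreover from this I obtain i where "i \<in> I" "x \<in> ball (q i) d" by auto
      ultimately show "x \<in> (\<Union>p\<in>F. ball p d)" unfolding F_def by blast
    qed
    have FK: "\<And>p. p \<in> F \<Longrightarrow> K' \<inter> ball p d \<noteq> {}" by (simp add: F_def)
    have "approx_image F (1 / real (Suc k)) K'"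
      unfolding approx_image_def
    proof (intro exI[of _ "\<lambda>x. x"] exI[of _ d] conjI ballI)
      have "(\<Union>p\<in>F. ball p d) \<subseteq> (\<Union>p\<in>F. cball p d)" by (intro UN_mono) auto
      with KF show "(\<lambda>x. x) ` K' \<subseteq> (\<Union>p\<in>F. cball p d)" by simp
    qed (use d FK in \<open>auto simp: linear_ident\<close>)
    then have "approx_image F (1 / real (Suc k)) K" using approx F by blast
    then obtain T c where T: "linear T" "c < 1 / real (Suc k)"
      "T ` K \<subseteq> (\<Union>p\<in>F. cball p c)" "\<forall>p\<in>F. T ` K \<inter> ball p c \<noteq> {}"
      unfolding approx_image_def by blast
    have "\<exists>y\<in>K'. dist (T x) y < e" if "x \<in> K" for x
    proof -
      have "T x \<in> (\<Union>p\<in>F. cball p c)" using T(3) that by blast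
      then obtain p where p: "p \<in> F" "dist p (T x) \<le> c" by auto
      obtain y where y: "y \<in> K'" "dist p y < d" using FK[OF p(1)] by auto
      have "dist (T x) y < e"
        using p y T(2) d k dist_triangle[of "T x" y p] by (simp add: dist_commute)
      with y show ?thesis by blast
    qed
    moreover have "\<exists>x\<in>K. dist (T x) y < e" if y: "y \<in> K'" for y
    proof -
      obtain p where p: "p \<in> F" "dist p y < d" using KF y by auto
      obtain x where x: "x \<in> K" "dist p (T x) < c" using bspec[OF T(4) p(1)] by auto
      have "dist (T x) y < e"
        using p x T(2) d k dist_triangle[of "T x" y p] by (simp add: dist_commute)
      with x show ?thesis by blast
    qed
    ultimately show "\<exists>T. linear T \<and> (\<forall>x\<in>K. \<exists>y\<in>K'. dist (T x) y < e) \<and> (\<forall>y\<in>K'. \<exists>x\<in>K. dist (T x) y < e)"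
      using T(1) by blast
  qed
qed

text \<open>A linear map is determined by its values on \<open>Basis\<close>, and these may be moved
  to points of a dense sequence. A tolerance of \<open>e / DIM('a)\<close> for each basis vector
  adds up to \<open>e\<close>.\<close>

lemma countable_dense_linear_maps:
  obtains \<T> :: "('a::euclidean_space \<Rightarrow> 'a) set" where "countable \<T>" "\<And>T. T \<in> \<T> \<Longrightarrow> linear T"
    "\<And>T e. linear T \<Longrightarrow> e > 0 \<Longrightarrow> \<exists>S\<in>\<T>. \<forall>x. dist (T x) (S x) \<le> e * norm x"
proof -
  obtain q :: "nat \<Rightarrow> 'a" where q: "\<And>U. open U \<Longrightarrow> U \<noteq> {} \<Longrightarrow> \<exists>i. q i \<in> U"
    using dense_sequence by blast
  define S where "S t x = (\<Sum>b\<in>Basis. (x \<bullet> b) *\<^sub>R t b)" for t :: "'a \<Rightarrow> 'a" and x :: 'a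
  define \<T> where "\<T> = S ` (PiE Basis (\<lambda>_. range q))"
  show thesis
  proof
    show "countable \<T>" unfolding \<T>_def by (intro countable_image countable_PiE) auto
    have "linear (S t)" for t
      by (rule linearI) (simp_all add: S_def inner_add_left scaleR_add_left sum.distrib scaleR_sum_right)
    then show "linear T" if "T \<in> \<T>" for T using that by (auto simp: \<T>_def)
    fix T :: "'a \<Rightarrow> 'a" and e :: real assume T: "linear T" and e: "e > 0"
    have "\<exists>i. dist (T b) (q i) < e / DIM('a)" for b
    proof -
      have "0 < e / DIM('a)" using e by (intro divide_pos_pos) simp_all
      then have "ball (T b) (e / DIM('a)) \<noteq> {}" by simp
      with q[of "ball (T b) (e / DIM('a))"] show ?thesis by auto
    qed
    then obtain i where i: "\<And>b. dist (T b) (q (i b)) < e / DIM('a)" by metis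
    \<comment> \<open>The restriction makes \<open>t\<close> extensional, as membership in
      \<open>PiE\<close> demands.\<close>
    define t where "t = restrict (\<lambda>b. q (i b)) Basis"
    have "dist (T x) (S t x) \<le> e * norm x" for x
    proof -
      have "T x = (\<Sum>b\<in>Basis. (x \<bullet> b) *\<^sub>R T b)"
        by (subst euclidean_representation[of x, symmetric])
          (simp only: linear_sum[OF T] linear_scale[OF T])
      then have "T x - S t x = (\<Sum>b\<in>Basis. (x \<bullet> b) *\<^sub>R (T b - q (i b)))"
        by (simp add: S_def t_def sum_subtractf scaleR_diff_right)
      also have "norm \<dots> \<le> (\<Sum>b\<in>(Basis::'a set). norm x * (e / DIM('a)))"
      proof (rule sum_norm_le)
        fix b :: 'a assume "b \<in> Basis"
        then have "\<bar>x \<bullet> b\<bar> * norm (T b - q (i b)) \<le> norm x * (e / DIM('a))"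
          using i[of b] e by (intro mult_mono Basis_le_norm) (auto simp: dist_norm less_imp_le)
        then show "norm ((x \<bullet> b) *\<^sub>R (T b - q (i b))) \<le> norm x * (e / DIM('a))" by simp
      qed
      finally show ?thesis by (simp add: dist_norm mult.commute)
    qed
    moreover have "S t \<in> \<T>" by (auto simp: \<T>_def t_def)
    ultimately show "\<exists>S\<in>\<T>. \<forall>x. dist (T x) (S x) \<le> e * norm x" by blast
  qed
qed

text \<open>For fixed \<open>T\<close> and \<open>d\<close> the condition is a finite combination of
  hit sets. The slack in the radius allows \<open>T\<close> to range over a countable dense family
  and \<open>d\<close> over the rationals.\<close>

lemma approx_image_measurable:
  fixes F :: "'a::euclidean_space set"
  assumes F: "finite F"
  shows "{K. compact K \<and> approx_image F e K} \<in> sets effros_compact"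
proof -
  obtain \<T> :: "('a \<Rightarrow> 'a) set" where \<T>: "countable \<T>" "\<And>T. T \<in> \<T> \<Longrightarrow> linear T"
    "\<And>T e. linear T \<Longrightarrow> e > 0 \<Longrightarrow> \<exists>S\<in>\<T>. \<forall>x. dist (T x) (S x) \<le> e * norm x"
    using countable_dense_linear_maps by blast
  define A where "A T d = {K. compact K \<and> T ` K \<subseteq> (\<Union>p\<in>F. cball p d) \<and> (\<forall>p\<in>F. T ` K \<inter> ball p d \<noteq> {})}"
    for T :: "'a \<Rightarrow> 'a" and d
  have A: "A T d \<in> sets effros_compact" if "T \<in> \<T>" for T d
  proof -
    have cont: "continuous_on UNIV T" using \<T>(2)[OF that] linear_continuous_on linear_linear by blast
    define C where "C = T -` (\<Union>p\<in>F. cball p d)"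
    have "closed C" unfolding C_def
      using F cont by (intro closed_vimage closed_UN) auto
    have op: "open (T -` ball p d)" for p using cont by (intro open_vimage) auto
    \<comment> \<open>Containment in the closed set \<open>C\<close> means not hitting its
      complement; the second factor is a finite intersection of hit sets written through
      complements.\<close>
    have "A T d = (space effros_compact - {K. compact K \<and> K \<inter> (- C) \<noteq> {}}) \<inter>
        (space effros_compact - (\<Union>p\<in>F. space effros_compact - {K. compact K \<and> K \<inter> T -` ball p d \<noteq> {}}))"
      unfolding A_def C_def space_effros_compact by (safe; force)
    also have "\<dots> \<in> sets effros_compact"
      using F \<open>closed C\<close> op
      by (intro sets.Int sets.compl_sets hits_in_effros sets.finite_UN) auto
    finally show ?thesis .
  qed
  have "{K. compact K \<and> approx_image F e K} = (\<Union>d\<in>\<rat> \<inter> {..<e}. \<Union>T\<in>\<T>. A T d)"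
  proof (intro set_eqI iffI)
    fix K assume "K \<in> (\<Union>d\<in>\<rat> \<inter> {..<e}. \<Union>T\<in>\<T>. A T d)"
    then show "K \<in> {K. compact K \<and> approx_image F e K}"
      unfolding A_def approx_image_def using \<T>(2) by blast
  next
    fix K assume "K \<in> {K. compact K \<and> approx_image F e K}"
    then obtain T d where K: "compact K" and T: "linear T" "d < e" "T ` K \<subseteq> (\<Union>p\<in>F. cball p d)"
      "\<forall>p\<in>F. T ` K \<inter> ball p d \<noteq> {}" unfolding approx_image_def by blast
    obtain d' where d': "d' \<in> \<rat>" "d < d'" "d' < e" using Rats_dense_in_real T(2) by blast
    obtain M where M: "M > 0" "\<And>x. x \<in> K \<Longrightarrow> norm x \<le> M"
      using compact_imp_bounded[OF K] bounded_pos by metis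
    \<comment> \<open>The tolerance is scaled by the norm bound \<open>M\<close>, so on
      \<open>K\<close> the map moves by at most \<open>d' - d\<close>, which is the gain in the
      radius.\<close>
    obtain S where S: "S \<in> \<T>" "\<And>x. dist (T x) (S x) \<le> (d' - d) / M * norm x"
      using \<T>(3)[OF T(1), of "(d' - d) / M"] d' M by auto
    have near: "dist (T x) (S x) \<le> d' - d" if "x \<in> K" for x
    proof -
      have "(d' - d) / M * norm x \<le> (d' - d) / M * M"
        using d' M that by (intro mult_left_mono) auto
      with S(2)[of x] M show ?thesis by simp
    qed
    have "S ` K \<subseteq> (\<Union>p\<in>F. cball p d')"
    proof
      fix y assume "y \<in> S ` K"
      then obtain x where x: "x \<in> K" "y = S x" by auto
      then have "T x \<in> (\<Union>p\<in>F. cball p d)" using T(3) by blast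
      then obtain p where "p \<in> F" "dist p (T x) \<le> d" by auto
      then show "y \<in> (\<Union>p\<in>F. cball p d')"
        using near[OF x(1)] x(2) dist_triangle[of p "S x" "T x"] by force
    qed
    moreover have "S ` K \<inter> ball p d' \<noteq> {}" if "p \<in> F" for p
    proof -
      obtain x where x: "x \<in> K" "dist p (T x) < d" using bspec[OF T(4) \<open>p \<in> F\<close>] by auto
      then have "dist p (S x) < d'" using near[OF x(1)] dist_triangle[of p "S x" "T x"] by simp
      with x show ?thesis by auto
    qed
    ultimately have "K \<in> A S d'" using K by (simp add: A_def)
    then show "K \<in> (\<Union>d\<in>\<rat> \<inter> {..<e}. \<Union>T\<in>\<T>. A T d)" using d' S(1) by auto
  qed
  also have "\<dots> \<in> sets effros_compact"
    using A \<T>(1) by (intro sets.countable_UN' countable_Int1 countable_rat) auto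
  finally show ?thesis .
qed

text \<open>The coordinates of \<open>f\<close> are the truth values of the conditions indexed by a
  finite set of dense points and a tolerance. Equal values give linear images in both directions by
  \<open>linear_image_if_approx_image\<close>; the converse is the invariance
  \<open>approx_image_linear_image\<close>.\<close>

lemma linear_image_classification:
  obtains f :: "'a::euclidean_space set \<Rightarrow> nat \<Rightarrow> real" where "f \<in> borel_measurable effros_compact"
    "\<And>K K'. compact K \<Longrightarrow> compact K' \<Longrightarrow>
      f K = f K' \<longleftrightarrow> (\<exists>T. linear T \<and> T ` K = K') \<and> (\<exists>T. linear T \<and> T ` K' = K)"
proof -
  obtain q :: "nat \<Rightarrow> 'a" where q: "\<And>U. open U \<Longrightarrow> U \<noteq> {} \<Longrightarrow> \<exists>i. q i \<in> U"
    using dense_sequence by blast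
  define I where "I = {F. F \<subseteq> range q \<and> finite F} \<times> (UNIV :: nat set)"
  have I: "countable I" "I \<noteq> {}"
    using countable_Collect_finite_subset[of "range q"]
    by (auto simp: I_def conj_commute intro!: countable_SIGMA)
  define g where "g = from_nat_into I"
  have rg: "range g = I" unfolding g_def using I by (simp add: range_from_nat_into)
  define f where "f K n = (indicat_real {K. compact K \<and> approx_image (fst (g n)) (1 / real (Suc (snd (g n)))) K} K)" for K n
  have f_eqI: "approx_image F (1 / real (Suc k)) K \<longleftrightarrow> approx_image F (1 / real (Suc k)) K'"
    if "f K = f K'" "compact K" "compact K'" "finite F" "F \<subseteq> range q" for F k K K'
  proof -
    have "(F, k) \<in> range g" using that by (simp add: rg I_def)
    then obtain n where "g n = (F, k)" by (metis rangeE)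
    with fun_cong[OF that(1), of n] that(2,3) show ?thesis
      by (auto simp: f_def indicator_def split: if_splits)
  qed
  show thesis
  proof
    show "f \<in> borel_measurable effros_compact"
    proof (rule measurable_coordinatewise_then_product)
      fix n
      have "g n \<in> I" using rg by auto
      then have "finite (fst (g n))" by (auto simp: I_def)
      then show "(\<lambda>K. f K n) \<in> borel_measurable effros_compact"
        unfolding f_def by (intro borel_measurable_indicator approx_image_measurable)
    qed
    fix K K' :: "'a set" assume K: "compact K" "compact K'"
    show "f K = f K' \<longleftrightarrow> (\<exists>T. linear T \<and> T ` K = K') \<and> (\<exists>T. linear T \<and> T ` K' = K)"
    proof
      assume "f K = f K'"
      then show "(\<exists>T. linear T \<and> T ` K = K') \<and> (\<exists>T. linear T \<and> T ` K' = K)"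
        using linear_image_if_approx_image[OF K(1) K(2) q] linear_image_if_approx_image[OF K(2) K(1) q] f_eqI K
        by blast
    next
      assume "(\<exists>T. linear T \<and> T ` K = K') \<and> (\<exists>T. linear T \<and> T ` K' = K)"
      then have "approx_image F e K \<longleftrightarrow> approx_image F e K'" for F e
        using approx_image_linear_image by metis
      then show "f K = f K'" using K by (auto simp: f_def fun_eq_iff indicator_def)
    qed
  qed
qed

section \<open>Invertibility of mutual linear surjections\<close>

text \<open>Surjections in both directions force the spans to have equal dimension. Hence
  \<open>S\<close> sends a basis of the span of \<open>A\<close> to equally many independent vectors
  and is injective on that span. The inverse \<open>R\<close> may differ from
  \<open>T\<close>.\<close>

lemma linear_images_inverse:
  fixes A B :: "'a::euclidean_space set"
  assumes S: "linear S" "S ` A = B" and T: "linear T" "T ` B = A"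
  obtains R where "linear R" "\<And>x. x \<in> A \<Longrightarrow> R (S x) = x"
proof -
  obtain C where C: "C \<subseteq> A" "independent C" "A \<subseteq> span C" "card C = dim A"
    using basis_exists[of A] by blast
  have finC: "finite C" using C(2) by (rule independent_imp_finite)
  have spans: "B \<subseteq> span (S ` C)"
    using S C(3) linear_span_image[OF S(1), of C] by blast
  have "dim A \<le> dim B" using dim_image_le[OF T(1), of B] T by simp
  moreover have "dim B \<le> card (S ` C)" using spans finC by (intro dim_le_card) auto
  moreover have "card (S ` C) \<le> card C" by (rule card_image_le[OF finC])
  ultimately have card: "card (S ` C) = card C" "card (S ` C) \<le> dim B" using C(4) by auto
  have "independent (S ` C)"
    using card(2) spans C(1) S(2) finC by (intro card_le_dim_spanning[of _ B]) auto
  moreover have "inj_on S C" using finC card(1) by (rule eq_card_imp_inj_on)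
  ultimately have "inj_on S (span C)"
    using linear_inj_on_span_iff_independent_image[OF S(1)] by blast
  moreover have "span A = span C" using C(1,3) by (metis span_mono span_span subset_antisym)
  ultimately have "inj_on S (span A)" by simp
  then obtain g where "linear g" "\<forall>v\<in>span A. g (S v) = v"
    using linear_exists_left_inverse_on[OF S(1) subspace_span] by blast
  then show thesis using that span_base by metis
qed

section \<open>Degree 1 maps as linear maps of Gram matrices\<close>

text \<open>Linearity below is over the reals: \<open>sesquilinear_on\<close> corresponds to real-linear functionals
  because conjugation merely transposes a Gram matrix.\<close>

definition gram_matrix :: "complex ^ 'n \<Rightarrow> complex ^ ('n option) ^ ('n::finite option)" where
  "gram_matrix z = (\<chi> i j. ext_coord z i * cnj (ext_coord z j))"

lemma continuous_on_gram_matrix: "continuous_on (S :: (complex ^ 'n::finite) set) gram_matrix"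
proof -
  have "continuous_on S (\<lambda>z. ext_coord z i)" for i :: "'n option"
    by (cases i) (auto intro!: continuous_intros)
  then show ?thesis unfolding gram_matrix_def by (intro continuous_intros)
qed

text \<open>The convention for index 0 makes \<open>gram_matrix\<close> injective, with a linear
  left inverse.\<close>

lemma gram_matrix_column: "(\<chi> k. gram_matrix z $ Some k $ None) = z"
  by (simp add: gram_matrix_def vec_eq_iff)

text \<open>The splitting of a real-linear map into its complex-linear and conjugate-linear parts,
  with the Wirtinger coefficients.\<close>

lemma linear_complex_decomposition:
  assumes "linear (g :: complex \<Rightarrow> complex)"
  shows "g w = (g 1 - \<i> * g \<i>) / 2 * w + (g 1 + \<i> * g \<i>) / 2 * cnj w"
proof -
  have w: "w = Re w *\<^sub>R 1 + Im w *\<^sub>R \<i>" "cnj w = Re w *\<^sub>R 1 - Im w *\<^sub>R \<i>"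
    by (simp_all add: complex_eq_iff)
  have "g w = Re w *\<^sub>R g 1 + Im w *\<^sub>R g \<i>"
    using assms by (subst w(1)) (simp only: linear_add linear_scale)
  also have "\<dots> = (g 1 - \<i> * g \<i>) / 2 * (of_real (Re w) + of_real (Im w) * \<i>)
      + (g 1 + \<i> * g \<i>) / 2 * (of_real (Re w) - of_real (Im w) * \<i>)"
    by (simp add: scaleR_conv_of_real field_simps)
  finally show ?thesis by (metis w scaleR_conv_of_real mult.right_neutral)
qed

lemma linear_axis: "linear (\<lambda>w. axis i w :: 'a::real_vector ^ 'n)"
  by (rule linearI) (simp_all add: axis_def vec_eq_iff)

lemma matrix_eq_sum_axis: "M = (\<Sum>i\<in>UNIV. \<Sum>j\<in>UNIV. axis i (axis j (M $ i $ j)))"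
  for M :: "'a::comm_monoid_add ^ 'n::finite ^ 'm::finite"
proof -
  have "(\<Sum>i\<in>UNIV. \<Sum>j\<in>UNIV. axis i (axis j (M $ i $ j))) $ a $ b = M $ a $ b" for a b
  proof -
    have "(\<Sum>i\<in>UNIV. \<Sum>j\<in>UNIV. axis i (axis j (M $ i $ j))) $ a $ b =
        (\<Sum>i\<in>UNIV. \<Sum>j\<in>UNIV. if b = j then if a = i then M $ i $ j else 0 else 0)"
      unfolding sum_component by (intro sum.cong refl) (simp add: axis_def)
    also have "\<dots> = M $ a $ b" by simp
    finally show ?thesis .
  qed
  then show ?thesis by (simp add: vec_eq_iff)
qed

lemma sesquilinear_on_iff:
  fixes D :: "(complex ^ 'n::finite) set"
  shows "sesquilinear_on D h \<longleftrightarrow> (\<exists>l. linear l \<and> (\<forall>z\<in>D. h z = l (gram_matrix z)))"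
proof
  assume "sesquilinear_on D h"
  then obtain b where b: "\<And>z. z \<in> D \<Longrightarrow>
      h z = (\<Sum>i\<in>UNIV. \<Sum>j\<in>UNIV. b i j * ext_coord z i * cnj (ext_coord z j))"
    unfolding sesquilinear_on_def by blast
  define l where "l M = (\<Sum>i\<in>UNIV. \<Sum>j\<in>UNIV. b i j * M $ i $ j)" for M :: "complex ^ ('n option) ^ ('n option)"
  have "linear l"
    by (rule linearI) (simp_all add: l_def distrib_left sum.distrib scaleR_sum_right)
  moreover have "h z = l (gram_matrix z)" if "z \<in> D" for z
    using b[OF that] by (simp add: l_def gram_matrix_def mult.assoc)
  ultimately show "\<exists>l. linear l \<and> (\<forall>z\<in>D. h z = l (gram_matrix z))" by blast
next
  assume "\<exists>l. linear l \<and> (\<forall>z\<in>D. h z = l (gram_matrix z))"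
  then obtain l where l: "linear l" "\<And>z. z \<in> D \<Longrightarrow> h z = l (gram_matrix z)" by blast
  define g where "g i j w = l (axis i (axis j w))" for i j w
  have g: "linear (g i j)" for i j
    using linear_compose[OF linear_compose[OF linear_axis linear_axis] l(1)] by (simp add: g_def[abs_def] o_def)
  define a where "a i j = (g i j 1 - \<i> * g i j \<i>) / 2" for i j
  define b where "b i j = (g i j 1 + \<i> * g i j \<i>) / 2" for i j
  \<comment> \<open>The conjugate-linear part acts on the conjugate of entry (i, j), which is entry
    (j, i); hence the swapped indices in \<open>b j i\<close>.\<close>
  have "h z = (\<Sum>i\<in>UNIV. \<Sum>j\<in>UNIV. (a i j + b j i) * ext_coord z i * cnj (ext_coord z j))"
    if "z \<in> D" for z
  proof -
    let ?x = "\<lambda>i. ext_coord z i"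
    have "gram_matrix z = (\<Sum>i\<in>UNIV. \<Sum>j\<in>UNIV. axis i (axis j (?x i * cnj (?x j))))"
      by (subst matrix_eq_sum_axis) (simp add: gram_matrix_def)
    then have "l (gram_matrix z) = (\<Sum>i\<in>UNIV. \<Sum>j\<in>UNIV. g i j (?x i * cnj (?x j)))"
      by (simp add: linear_sum[OF l(1)] g_def)
    also have "\<dots> = (\<Sum>i\<in>UNIV. \<Sum>j\<in>UNIV. a i j * ?x i * cnj (?x j)) + (\<Sum>i\<in>UNIV. \<Sum>j\<in>UNIV. b i j * ?x j * cnj (?x i))"
      unfolding sum.distrib[symmetric]
      by (intro sum.cong refl, subst linear_complex_decomposition[OF g]) (simp add: a_def b_def mult_ac)
    also have "(\<Sum>i\<in>UNIV. \<Sum>j\<in>UNIV. b i j * ?x j * cnj (?x i)) = (\<Sum>i\<in>UNIV. \<Sum>j\<in>UNIV. b j i * ?x i * cnj (?x j))"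
      by (rule sum.swap)
    finally show ?thesis using l(2)[OF that] by (simp add: sum.distrib distrib_right)
  qed
  then show "sesquilinear_on D h" unfolding sesquilinear_on_def by (intro exI[of _ "\<lambda>i j. a i j + b j i"]) blast
qed

lemma degree1_map_iff:
  fixes D :: "(complex ^ 'n::finite) set"
  shows "degree1_map D f \<longleftrightarrow> closed D \<and> (\<exists>T. linear T \<and> (\<forall>z\<in>D. T (gram_matrix z) = gram_matrix (f z)))"
proof
  assume "degree1_map D f"
  then have f: "closed D" "\<And>k. sesquilinear_on D (\<lambda>z. f z $ k)"
    "\<And>k m. sesquilinear_on D (\<lambda>z. f z $ k * cnj (f z $ m))"
    by (auto simp: degree1_map_def)
  \<comment> \<open>Four kinds of entries occur: the constant 1, which is the (\<open>None\<close>,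
    \<open>None\<close>) entry of \<open>gram_matrix z\<close> itself; the components of
    \<open>f\<close>; their conjugates, obtained by conjugating the real-linear functional; and the
    products.\<close>
  have entry: "\<exists>l. linear l \<and> (\<forall>z\<in>D. gram_matrix (f z) $ i $ j = l (gram_matrix z))" for i j
  proof (cases i)
    case None
    show ?thesis
    proof (cases j)
      case None
      have "linear (\<lambda>M :: complex ^ ('n option) ^ ('n option). M $ None $ None)"
        by (rule linearI) simp_all
      then show ?thesis using None \<open>i = None\<close>
        by (intro exI[of _ "\<lambda>M. M $ None $ None"]) (simp add: gram_matrix_def)
    next
      case (Some m)
      obtain l where l: "linear l" "\<And>z. z \<in> D \<Longrightarrow> f z $ m = l (gram_matrix z)"
        using f(2)[of m] unfolding sesquilinear_on_iff by blast
      have "linear (\<lambda>M. cnj (l M))"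
        by (rule linearI) (simp_all add: linear_add[OF l(1)] linear_scale[OF l(1)])
      then show ?thesis using l Some None
        by (intro exI[of _ "\<lambda>M. cnj (l M)"]) (simp add: gram_matrix_def)
    qed
  next
    case (Some k)
    then show ?thesis
      using f(2)[of k] f(3)[of k] unfolding sesquilinear_on_iff
      by (cases j) (simp_all add: gram_matrix_def)
  qed
  then obtain l where l: "\<And>i j. linear (l i j)"
    "\<And>i j z. z \<in> D \<Longrightarrow> gram_matrix (f z) $ i $ j = l i j (gram_matrix z)"
    by metis
  define T where "T M = (\<chi> i j. l i j M)" for M
  have "linear T"
    by (rule linearI) (simp_all add: T_def vec_eq_iff linear_add[OF l(1)] linear_scale[OF l(1)])
  moreover have "T (gram_matrix z) = gram_matrix (f z)" if "z \<in> D" for z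
    using l(2)[OF that] by (simp add: T_def vec_eq_iff)
  ultimately show "closed D \<and> (\<exists>T. linear T \<and> (\<forall>z\<in>D. T (gram_matrix z) = gram_matrix (f z)))"
    using f(1) by blast
next
  assume "closed D \<and> (\<exists>T. linear T \<and> (\<forall>z\<in>D. T (gram_matrix z) = gram_matrix (f z)))"
  then obtain T where T: "closed D" "linear T" "\<And>z. z \<in> D \<Longrightarrow> T (gram_matrix z) = gram_matrix (f z)"
    by blast
  have lin: "linear (\<lambda>M. T M $ i $ j)" for i j
    by (rule linearI) (simp_all add: linear_add[OF T(2)] linear_scale[OF T(2)])
  have entry: "sesquilinear_on D (\<lambda>z. gram_matrix (f z) $ i $ j)" for i j
    unfolding sesquilinear_on_iff using lin[of i j] T(3) by (intro exI[of _ "\<lambda>M. T M $ i $ j"]) simp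
  show "degree1_map D f"
    unfolding degree1_map_def
  proof (intro conjI allI T(1))
    fix k m
    show "sesquilinear_on D (\<lambda>z. f z $ k)"
      using entry[of "Some k" None] by (simp add: gram_matrix_def)
    show "sesquilinear_on D (\<lambda>z. f z $ k * cnj (f z $ m))"
      using entry[of "Some k" "Some m"] by (simp add: gram_matrix_def)
  qed
qed

text \<open>Degree 1 maps in both directions give the two linear surjections. Conversely the given
  \<open>S\<close> and \<open>T\<close> need not be inverse to each other, but \<open>S\<close> has
  a linear inverse on the Gram matrices of \<open>D\<close>; reading off column \<open>None\<close>
  turns \<open>S\<close> and this inverse into the homeomorphism and its inverse.\<close>

lemma degree1_homeomorphic_iff:
  fixes D D' :: "(complex ^ 'n::finite) set"
  assumes "compact D" "compact D'"
  shows "degree1_homeomorphic D D' \<longleftrightarrow>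
    (\<exists>T. linear T \<and> T ` gram_matrix ` D = gram_matrix ` D') \<and>
    (\<exists>T. linear T \<and> T ` gram_matrix ` D' = gram_matrix ` D)"
proof
  assume "degree1_homeomorphic D D'"
  then obtain \<phi> \<psi> where hom: "homeomorphism D D' \<phi> \<psi>" and deg: "degree1_map D \<phi>" "degree1_map D' \<psi>"
    unfolding degree1_homeomorphic_def by blast
  have im: "\<phi> ` D = D'" "\<psi> ` D' = D" using hom by (auto simp: homeomorphism_def)
  have "\<exists>T. linear T \<and> T ` gram_matrix ` E = gram_matrix ` f ` E" if "degree1_map E f" for E and f :: "complex ^ 'n \<Rightarrow> _"
    using that unfolding degree1_map_iff image_image by (metis (mono_tags, lifting) image_cong)
  from this[OF deg(1)] this[OF deg(2)] im
  show "(\<exists>T. linear T \<and> T ` gram_matrix ` D = gram_matrix ` D') \<and>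
    (\<exists>T. linear T \<and> T ` gram_matrix ` D' = gram_matrix ` D)" by simp
next
  assume "(\<exists>T. linear T \<and> T ` gram_matrix ` D = gram_matrix ` D') \<and>
    (\<exists>T. linear T \<and> T ` gram_matrix ` D' = gram_matrix ` D)"
  then obtain S T where S: "linear S" "S ` gram_matrix ` D = gram_matrix ` D'"
    and T: "linear T" "T ` gram_matrix ` D' = gram_matrix ` D"
    by (elim conjE exE) (rule that)
  obtain R where R: "linear R" "\<And>x. x \<in> gram_matrix ` D \<Longrightarrow> R (S x) = x"
    using linear_images_inverse[OF S T] by blast
  define col where "col M = (\<chi> k. M $ Some k $ None)" for M :: "complex ^ ('n option) ^ ('n option)"
  have col: "col (gram_matrix z) = z" for z
    unfolding col_def by (rule gram_matrix_column)
  define \<phi> where "\<phi> z = col (S (gram_matrix z))" for z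
  define \<psi> where "\<psi> w = col (R (gram_matrix w))" for w
  have \<phi>: "\<phi> z \<in> D' \<and> gram_matrix (\<phi> z) = S (gram_matrix z) \<and> \<psi> (\<phi> z) = z" if "z \<in> D" for z
  proof -
    have "S (gram_matrix z) \<in> gram_matrix ` D'" using S that by blast
    then obtain w where w: "w \<in> D'" "S (gram_matrix z) = gram_matrix w" by blast
    have "\<phi> z = w" by (simp add: \<phi>_def w col)
    moreover have "\<psi> w = z" using R(2) that w by (metis \<psi>_def col imageI)
    ultimately show ?thesis using w by simp
  qed
  have \<psi>: "\<psi> w \<in> D \<and> gram_matrix (\<psi> w) = R (gram_matrix w) \<and> \<phi> (\<psi> w) = w" if w: "w \<in> D'" for w
  proof -
    have "gram_matrix w \<in> S ` gram_matrix ` D" using S that by blast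
    then obtain z where z: "z \<in> D" "gram_matrix w = S (gram_matrix z)" by blast
    have "R (gram_matrix w) = gram_matrix z" using R(2) z by auto
    moreover have "\<phi> z = w" using z by (metis \<phi>_def col)
    ultimately show ?thesis using \<phi>[OF z(1)] z by auto
  qed
  have cont: "continuous_on E (\<lambda>z. col (U (gram_matrix z)))" if "linear U" for E and U
  proof -
    have "continuous_on (gram_matrix ` E) (\<lambda>M. U M)" using that by (intro linear_continuous_on) (simp add: linear_linear)
    then have "continuous_on E (\<lambda>z. U (gram_matrix z))"
      using continuous_on_compose2[OF _ continuous_on_gram_matrix] by blast
    then show ?thesis unfolding col_def by (intro continuous_intros)
  qed
  have "homeomorphism D D' \<phi> \<psi>"
    unfolding homeomorphism_def
  proof (intro conjI)
    show "\<phi> ` D = D'"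
    proof
      show "D' \<subseteq> \<phi> ` D" using \<psi> by (metis imageI subsetI)
    qed (use \<phi> in auto)
    show "\<psi> ` D' = D"
    proof
      show "D \<subseteq> \<psi> ` D'" using \<phi> by (metis imageI subsetI)
    qed (use \<psi> in auto)
    show "continuous_on D \<phi>" "continuous_on D' \<psi>"
      unfolding \<phi>_def[abs_def] \<psi>_def[abs_def] using cont S(1) R(1) by auto
  qed (use \<phi> \<psi> in auto)
  moreover have "degree1_map D \<phi>"
    unfolding degree1_map_iff using \<phi> S(1) assms by (metis compact_imp_closed)
  moreover have "degree1_map D' \<psi>"
    unfolding degree1_map_iff using \<psi> R(1) assms by (metis compact_imp_closed)
  ultimately show "degree1_homeomorphic D D'"
    unfolding degree1_homeomorphic_def by blast
qed

section \<open>Measurability of the classifying map and smoothness\<close>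

lemma image_measurable_effros_compact:
  fixes h :: "'a::topological_space \<Rightarrow> 'b::topological_space"
  assumes "continuous_on UNIV h"
  shows "(\<lambda>K. h ` K) \<in> measurable effros_compact effros_compact"
proof (rule measurable_sigma_sets[OF sets_effros_compact])
  show "(\<lambda>K. h ` K) \<in> space effros_compact \<rightarrow> {K. compact K}"
    using assms by (auto simp: space_effros_compact intro: compact_continuous_image continuous_on_subset)
  fix \<U> assume "\<U> \<in> {{K :: 'b set. compact K \<and> K \<inter> U \<noteq> {}} |U. open U}"
  then obtain U where U: "open U" "\<U> = {K. compact K \<and> K \<inter> U \<noteq> {}}" by blast
  have "(\<lambda>K. h ` K) -` \<U> \<inter> space effros_compact = {K. compact K \<and> K \<inter> h -` U \<noteq> {}}"
    using assms by (auto simp: U space_effros_compact intro: compact_continuous_image continuous_on_subset)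
  also have "\<dots> \<in> sets effros_compact"
    using assms U(1) by (intro hits_in_effros open_vimage)
  finally show "(\<lambda>K. h ` K) -` \<U> \<inter> space effros_compact \<in> sets effros_compact" .
qed auto

theorem theorem4p14:
  shows "smooth_equivalence (effros_compact :: (complex ^ 'n::finite) set measure) degree1_rel"
proof -
  let ?Q = "gram_matrix :: complex ^ 'n \<Rightarrow> _"
  obtain f :: "(complex ^ ('n option) ^ ('n option)) set \<Rightarrow> nat \<Rightarrow> real" where f: "f \<in> borel_measurable effros_compact"
    "\<And>K K'. compact K \<Longrightarrow> compact K' \<Longrightarrow>
      f K = f K' \<longleftrightarrow> (\<exists>T. linear T \<and> T ` K = K') \<and> (\<exists>T. linear T \<and> T ` K' = K)"
    using linear_image_classification by blast
  define F where "F D = f (?Q ` D)" for D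
  have rel: "(D, D') \<in> degree1_rel \<longleftrightarrow> F D = F D'" if "compact D" "compact D'" for D D'
    using that f(2)[of "?Q ` D" "?Q ` D'"] degree1_homeomorphic_iff[OF that]
    by (simp add: degree1_rel_def F_def compact_continuous_image continuous_on_gram_matrix)
  have borel: "borel_of (euclidean :: (nat \<Rightarrow> real) topology) = borel"
    by (simp add: borel_of_def borel_def)
  have "polish_topology (euclidean :: (nat \<Rightarrow> real) topology)"
    unfolding polish_topology_def
    by (intro conjI completely_metrizable_space_euclidean second_countable_imp_separable_space
        second_countable_euclidean)
  moreover have "F \<in> measurable effros_compact (borel_of euclidean)"
    unfolding borel F_def
    using measurable_compose[OF image_measurable_effros_compact[OF continuous_on_gram_matrix] f(1)] .
  \<comment> \<open>On compact sets the relation is the kernel of \<open>F\<close>, so it inherits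
    reflexivity, symmetry and transitivity from equality.\<close>
  moreover have "equiv (space effros_compact) (degree1_rel :: ((complex ^ 'n) set \<times> _) set)"
  proof (rule equivI)
    have sub: "degree1_rel \<subseteq> {D :: (complex ^ 'n) set. compact D} \<times> {D. compact D}"
      by (auto simp: degree1_rel_def)
    then show "(degree1_rel :: ((complex ^ 'n) set \<times> _) set) \<subseteq> space effros_compact \<times> space effros_compact"
      by (simp add: space_effros_compact)
    show "refl_on (space effros_compact) (degree1_rel :: ((complex ^ 'n) set \<times> _) set)"
      using rel by (auto simp: refl_on_def space_effros_compact)
    show "sym (degree1_rel :: ((complex ^ 'n) set \<times> _) set)"
    proof (rule symI)
      fix A B :: "(complex ^ 'n) set"
      assume *: "(A, B) \<in> degree1_rel"
      then have "compact A" "compact B" using sub by auto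
      with * show "(B, A) \<in> degree1_rel" by (simp add: rel)
    qed
    show "trans (degree1_rel :: ((complex ^ 'n) set \<times> _) set)"
    proof (rule transI)
      fix A B C :: "(complex ^ 'n) set"
      assume *: "(A, B) \<in> degree1_rel" "(B, C) \<in> degree1_rel"
      then have "compact A" "compact B" "compact C" using sub by auto
      with * show "(A, C) \<in> degree1_rel" by (simp add: rel)
    qed
  qed
  ultimately show ?thesis
    unfolding smooth_equivalence_def
    by (intro conjI exI[of _ euclidean] exI[of _ F] standard_borel_effros_compact ballI rel)
      (simp_all add: space_effros_compact)
qed

end
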